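(* Let $(X,\mu)$ be a measure space and $\mathbb{R}_+=(0,\infty)$. Let $K:X\times X\times\mathbb{R}_+\to[0,+\infty)$ be measurable with $$\int_X K(x,y;t)\,d\mu(y)=1\quad\text{for a.e. }x\in X,\ \text{a.e. }t\in\mathbb{R}_+ .$$ Let $g:X\times\mathbb{R}_+\to[0,+\infty)$ be measurable with $g\in L^\infty(X\times\mathbb{R}_+)$, and suppose there exists $T_0>0$ such that $\inf_{(x,t)\in X\times(0,T_0)}g(x,t)=\beta_0>0$. Let $h:X\times\mathbb{R}_+\to[0,+\infty)$ be measurable. Let $G:[0,+\infty)\to[0,+\infty)$ be continuous, strictly increasing and concave, with $G(0)=0$. Assume that there exist $p_1,p_2\in C(\mathbb{R}_+,\mathbb{R}_+)$, a number $\xi>0$, and a homeomorphism $\varphi:[0,1]\to[0,1]$ such that (i) $p_1\not\equiv p_2$ and $\int_0^\infty p_2(t)\,dt=1$; (ii) $\lim_{t\to0+}\frac{p_1(t)}{p_2(t)}>0$; (iii) $p_1(t)\le h(x,t)\le p_2(t)$ for a.e. $x\in X$ and a.e. $t\in\mathbb{R}_+$; (iv) $\varphi(0)=0$, $\varphi(1)=1$, and $\varphi$ is concave; (v) $\xi-G(\xi)=\|g\|_{L^\infty(X\times\mathbb{R}_+)}$; (vi) $G(\sigma u)\ge\varphi(\sigma)G(u)$ for all $\sigma\in[0,1]$ and all $u\in[0,\xi]$. Then the integral equation $$u(x,t)=g(x,t)+\int_0^t\int_X K(x,y;t-s)\,h(y,s)\,G(u(y,s))\,d\mu(y)\,ds$$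 cannot have two distinct non-negative solutions in $L^\infty(X\times\mathbb{R}_+)$.
   Context: $\mathbb{R}_+=(0,\infty)$ carries Lebesgue measure, and $X\times\mathbb{R}_+$ and $X\times X\times\mathbb{R}_+$ carry the corresponding product measures; "a.e." refers to these measures. $C(\mathbb{R}_+,\mathbb{R}_+)$ denotes continuous functions from $(0,\infty)$ to $(0,\infty)$. The integral equation is understood to hold for a.e. $x\in X$ and a.e. $t\in\mathbb{R}_+$, and solutions are identified when they are equal almost everywhere. *)

theory Defs
  imports "HOL-Probability.Essential_Supremum"
begin

text \<open>
  The product of two arbitrary measure spaces: Caratheodory's outer measure built from countable
  covers by measurable rectangles, restricted to the product sigma-algebra. The library's
  \<open>M \<Otimes>\<^sub>M N\<close> is defined by iterated integration; the two agree for sigma-finite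
  factors (\<open>caratheodory_prod_eq_pair_measure\<close> below). Without sigma-finiteness of \<open>M\<close> they may
  differ: for counting measure on the Borel sets
  of \<open>[0,1]\<close> and Lebesgue measure on \<open>[0,1]\<close>, the diagonal is a null
  set of \<open>M \<Otimes>\<^sub>M N\<close>, although every one of its sections at a fixed second coordinate has
  measure 1. Null sets of the product below have null sections almost everywhere in both directions.
\<close>

definition rect_outer :: "'a measure \<Rightarrow> 'b measure \<Rightarrow> ('a \<times> 'b) set \<Rightarrow> ennreal" where
  "rect_outer M N E =
     Inf {(\<Sum>i. emeasure M (A i) * emeasure N (B i)) | A B.
            range A \<subseteq> sets M \<and> range B \<subseteq> sets N \<and> E \<subseteq> (\<Union>i::nat. A i \<times> B i)}"

definition caratheodory_prod :: "'a measure \<Rightarrow> 'b measure \<Rightarrow> ('a \<times> 'b) measure" where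
  "caratheodory_prod M N =
     measure_of (space M \<times> space N) {A \<times> B | A B. A \<in> sets M \<and> B \<in> sets N} (rect_outer M N)"

lemma space_caratheodory_prod: "space (caratheodory_prod M N) = space M \<times> space N"
  unfolding caratheodory_prod_def
  by (rule space_measure_of) (auto dest: sets.sets_into_space)

lemma sets_caratheodory_prod: "sets (caratheodory_prod M N) = sets (M \<Otimes>\<^sub>M N)"
  unfolding caratheodory_prod_def sets_pair_measure
  by (subst sets_measure_of)
     (auto dest: sets.sets_into_space intro!: arg_cong[where f="sigma_sets _"])

lemma rect_outer_le:
  assumes "\<And>i::nat. A i \<in> sets M" "\<And>i. B i \<in> sets N" "E \<subseteq> (\<Union>i. A i \<times> B i)"
  shows "rect_outer M N E \<le> (\<Sum>i. emeasure M (A i) * emeasure N (B i))"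
  unfolding rect_outer_def using assms
  by (intro Inf_lower CollectI exI[of _ A] exI[of _ B]) auto

lemma rect_outer_close:
  assumes "rect_outer M N E < e"
  shows "\<exists>A B. (\<forall>i::nat. A i \<in> sets M) \<and> (\<forall>i. B i \<in> sets N) \<and> E \<subseteq> (\<Union>i. A i \<times> B i) \<and>
           (\<Sum>i. emeasure M (A i) * emeasure N (B i)) < e"
proof -
  obtain A B where "range A \<subseteq> sets M" "range B \<subseteq> sets N" "E \<subseteq> (\<Union>i::nat. A i \<times> B i)"
    "(\<Sum>i. emeasure M (A i) * emeasure N (B i)) < e"
    using assms unfolding rect_outer_def Inf_less_iff by auto
  then show ?thesis
    by (intro exI[of _ A] exI[of _ B]) (simp add: image_subset_iff)
qed

lemma rect_outer_mono:
  assumes "E \<subseteq> F"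
  shows "rect_outer M N E \<le> rect_outer M N F"
proof -
  have "rect_outer M N E \<le> (\<Sum>i. emeasure M (A i) * emeasure N (B i))"
    if "range A \<subseteq> sets M" "range B \<subseteq> sets N" "F \<subseteq> (\<Union>i::nat. A i \<times> B i)" for A B
    using that assms by (intro rect_outer_le) (simp_all add: image_subset_iff)
  then show ?thesis
    unfolding rect_outer_def[of M N F] by (intro Inf_greatest) auto
qed

lemma rect_outer_empty: "rect_outer M N {} = 0"
  using rect_outer_le[of "\<lambda>_. {}" M "\<lambda>_. {}" N "{}"] by simp

lemma rect_outer_countably_subadditive:
  "rect_outer M N (\<Union>n::nat. E n) \<le> (\<Sum>n. rect_outer M N (E n))"
proof (rule ennreal_le_epsilon)
  fix e :: real
  assume "0 < e" "(\<Sum>n. rect_outer M N (E n)) < top"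
  then have lt: "\<And>n. rect_outer M N (E n) < rect_outer M N (E n) + e * (1/2)^Suc n"
    by (auto simp add: less_top dest!: ennreal_suminf_lessD)
  define Q where "Q n A B \<longleftrightarrow> (\<forall>i::nat. A i \<in> sets M) \<and> (\<forall>i. B i \<in> sets N) \<and>
      E n \<subseteq> (\<Union>i. A i \<times> B i) \<and>
      (\<Sum>i. emeasure M (A i) * emeasure N (B i)) < rect_outer M N (E n) + e * (1/2)^Suc n" for n A B
  have "\<forall>n. \<exists>A B. Q n A B"
    unfolding Q_def by (intro allI rect_outer_close lt)
  then obtain A B where AB: "\<And>n. Q n (A n) (B n)"
    by metis
  have A: "\<And>n i. A n i \<in> sets M" and B: "\<And>n i. B n i \<in> sets N"
    and cov: "\<And>n. E n \<subseteq> (\<Union>i. A n i \<times> B n i)"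
    and le: "\<And>n. (\<Sum>i. emeasure M (A n i) * emeasure N (B n i))
                  < rect_outer M N (E n) + e * (1/2)^Suc n"
    using AB unfolding Q_def by simp_all
  define A' where "A' = case_prod A \<circ> prod_decode"
  define B' where "B' = case_prod B \<circ> prod_decode"
  have "rect_outer M N (\<Union>n. E n) \<le> (\<Sum>i. emeasure M (A' i) * emeasure N (B' i))"
  proof (rule rect_outer_le)
    show "A' i \<in> sets M" "B' i \<in> sets N" for i
      using A B by (auto simp: A'_def B'_def split_def)
    show "(\<Union>n. E n) \<subseteq> (\<Union>i. A' i \<times> B' i)"
    proof
      fix z assume "z \<in> (\<Union>n. E n)"
      then obtain n i where "z \<in> A n i \<times> B n i" using cov by blast
      then have "z \<in> A' (prod_encode (n, i)) \<times> B' (prod_encode (n, i))"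
        by (simp add: A'_def B'_def)
      then show "z \<in> (\<Union>i. A' i \<times> B' i)" by blast
    qed
  qed
  also have "\<dots> = (\<Sum>i. (\<lambda>(n, i). emeasure M (A n i) * emeasure N (B n i)) (prod_decode i))"
    by (simp add: A'_def B'_def split_def)
  also have "\<dots> = (\<Sum>n. \<Sum>i. emeasure M (A n i) * emeasure N (B n i))"
    using suminf_ennreal_2dimen[where f = "\<lambda>(n, i). emeasure M (A n i) * emeasure N (B n i)"
        and g = "\<lambda>n. \<Sum>i. emeasure M (A n i) * emeasure N (B n i)"]
    by (simp add: comp_def)
  also have "\<dots> \<le> (\<Sum>n. rect_outer M N (E n) + e * (1/2) ^ Suc n)"
    using le by (intro suminf_le allI less_imp_le) auto
  also have "\<dots> = (\<Sum>n. rect_outer M N (E n)) + (\<Sum>n. ennreal e * ennreal ((1/2) ^ Suc n))"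
    using \<open>0 < e\<close> by (subst suminf_add[symmetric])
                     (auto simp del: ennreal_suminf_cmult simp add: ennreal_mult[symmetric])
  also have "\<dots> = (\<Sum>n. rect_outer M N (E n)) + e"
    unfolding ennreal_suminf_cmult
    by (subst suminf_ennreal_eq[OF zero_le_power power_half_series]) auto
  finally show "rect_outer M N (\<Union>n. E n) \<le> (\<Sum>n. rect_outer M N (E n)) + e" .
qed

lemma rect_outer_rectangle:
  assumes A: "A \<in> sets M" and B: "B \<in> sets N"
  shows "rect_outer M N (A \<times> B) = emeasure M A * emeasure N B"
proof (rule antisym)
  have "rect_outer M N (A \<times> B)
      \<le> (\<Sum>i::nat. emeasure M (if i = 0 then A else {}) * emeasure N (if i = 0 then B else {}))"
    using A B by (intro rect_outer_le) (auto split: if_splits)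
  also have "\<dots> = emeasure M A * emeasure N B"
    by (subst suminf_finite[of "{0}"]) auto
  finally show "rect_outer M N (A \<times> B) \<le> emeasure M A * emeasure N B" .
  show "emeasure M A * emeasure N B \<le> rect_outer M N (A \<times> B)"
    unfolding rect_outer_def
  proof (safe intro!: Inf_greatest)
    fix A' B' assume A': "range A' \<subseteq> sets M" and B': "range B' \<subseteq> sets N"
      and cov: "A \<times> B \<subseteq> (\<Union>i::nat. A' i \<times> B' i)"
    have "emeasure M A * emeasure N B = (\<integral>\<^sup>+x. emeasure N B * indicator A x \<partial>M)"
      using A by (subst nn_integral_cmult_indicator) (simp_all add: mult.commute)
    also have "\<dots> \<le> (\<integral>\<^sup>+x. (\<Sum>i. emeasure N (B' i) * indicator (A' i) x) \<partial>M)"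
    proof (rule nn_integral_mono)
      fix x
      show "emeasure N B * indicator A x \<le> (\<Sum>i. emeasure N (B' i) * indicator (A' i) x)"
      proof (cases "x \<in> A")
        case True
        let ?C = "\<lambda>i. if x \<in> A' i then B' i else {}"
        have "B \<subseteq> (\<Union>i. ?C i)"
          using cov True by fastforce
        then have "emeasure N B \<le> emeasure N (\<Union>i. ?C i)"
          using B' by (intro emeasure_mono) auto
        also have "\<dots> \<le> (\<Sum>i. emeasure N (?C i))"
          using B' by (intro emeasure_subadditive_countably) auto
        also have "\<dots> = (\<Sum>i. emeasure N (B' i) * indicator (A' i) x)"
          by (intro suminf_cong) auto
        finally show ?thesis using True by simp
      qed simp
    qed
    also have "\<dots> = (\<Sum>i. \<integral>\<^sup>+x. emeasure N (B' i) * indicator (A' i) x \<partial>M)"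
      using A' by (intro nn_integral_suminf) auto
    also have "\<dots> = (\<Sum>i. emeasure M (A' i) * emeasure N (B' i))"
      using A' by (intro suminf_cong, subst nn_integral_cmult_indicator) (auto simp: mult.commute)
    finally show "emeasure M A * emeasure N B \<le> (\<Sum>i. emeasure M (A' i) * emeasure N (B' i))" .
  qed
qed

lemma rect_outer_add: "rect_outer M N (E \<union> F) \<le> rect_outer M N E + rect_outer M N F"
proof -
  let ?E = "\<lambda>n::nat. if n = 0 then E else if n = 1 then F else {}"
  have "rect_outer M N (\<Union>n. ?E n) \<le> (\<Sum>n. rect_outer M N (?E n))"
    by (rule rect_outer_countably_subadditive)
  also have "(\<Union>n. ?E n) = E \<union> F"
    by (auto split: if_splits)
  also have "(\<Sum>n. rect_outer M N (?E n)) = rect_outer M N E + rect_outer M N F"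
    by (subst suminf_finite[of "{0, 1}"]) (auto simp: rect_outer_empty)
  finally show ?thesis .
qed

lemma rect_outer_split:
  assumes A: "A \<in> sets M" and B: "B \<in> sets N"
  shows "rect_outer M N (E \<inter> A \<times> B) + rect_outer M N (E - A \<times> B) \<le> rect_outer M N E"
proof -
  have "rect_outer M N (E \<inter> A \<times> B) + rect_outer M N (E - A \<times> B)
      \<le> (\<Sum>i. emeasure M (A' i) * emeasure N (B' i))"
    if A': "range A' \<subseteq> sets M" and B': "range B' \<subseteq> sets N" and cov: "E \<subseteq> (\<Union>i::nat. A' i \<times> B' i)"
    for A' B'
  proof -
    have m: "A' i \<in> sets M" "B' i \<in> sets N" for i
      using A' B' by auto
    have "rect_outer M N (E \<inter> A \<times> B) \<le> (\<Sum>i. emeasure M (A' i \<inter> A) * emeasure N (B' i \<inter> B))"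
    proof (rule rect_outer_le)
      show "E \<inter> A \<times> B \<subseteq> (\<Union>i. (A' i \<inter> A) \<times> (B' i \<inter> B))"
      proof
        fix z assume z: "z \<in> E \<inter> A \<times> B"
        then obtain i where "z \<in> A' i \<times> B' i" using cov by blast
        with z have "z \<in> (A' i \<inter> A) \<times> (B' i \<inter> B)" by auto
        then show "z \<in> (\<Union>i. (A' i \<inter> A) \<times> (B' i \<inter> B))" by (rule UN_I[OF UNIV_I])
      qed
    qed (use m A B in simp_all)
    moreover have "rect_outer M N (E - A \<times> B)
        \<le> (\<Sum>i. emeasure M (A' i - A) * emeasure N (B' i)) +
          (\<Sum>i. emeasure M (A' i \<inter> A) * emeasure N (B' i - B))"
    proof -
      have "rect_outer M N (E - A \<times> B)
          \<le> rect_outer M N ((\<Union>i. (A' i - A) \<times> B' i) \<union> (\<Union>i. (A' i \<inter> A) \<times> (B' i - B)))"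
      proof (intro rect_outer_mono subsetI)
        fix z assume z: "z \<in> E - A \<times> B"
        then obtain i where "z \<in> A' i \<times> B' i" using cov by blast
        with z have "z \<in> (A' i - A) \<times> B' i \<or> z \<in> (A' i \<inter> A) \<times> (B' i - B)" by auto
        then show "z \<in> (\<Union>i. (A' i - A) \<times> B' i) \<union> (\<Union>i. (A' i \<inter> A) \<times> (B' i - B))"
          by (elim disjE) (rule UnI1 UnI2, rule UN_I[OF UNIV_I], assumption)+
      qed
      also have "\<dots> \<le> rect_outer M N (\<Union>i. (A' i - A) \<times> B' i) +
                      rect_outer M N (\<Union>i. (A' i \<inter> A) \<times> (B' i - B))"
        by (rule rect_outer_add)
      also have "\<dots> \<le> (\<Sum>i. emeasure M (A' i - A) * emeasure N (B' i)) +
                      (\<Sum>i. emeasure M (A' i \<inter> A) * emeasure N (B' i - B))"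
        using m A B by (intro add_mono rect_outer_le) simp_all
      finally show ?thesis .
    qed
    ultimately have "rect_outer M N (E \<inter> A \<times> B) + rect_outer M N (E - A \<times> B)
        \<le> (\<Sum>i. emeasure M (A' i \<inter> A) * emeasure N (B' i \<inter> B)) +
          ((\<Sum>i. emeasure M (A' i - A) * emeasure N (B' i)) +
           (\<Sum>i. emeasure M (A' i \<inter> A) * emeasure N (B' i - B)))"
      by (rule add_mono)
    also have "\<dots> = (\<Sum>i. emeasure M (A' i \<inter> A) * emeasure N (B' i \<inter> B) +
          (emeasure M (A' i - A) * emeasure N (B' i) +
           emeasure M (A' i \<inter> A) * emeasure N (B' i - B)))"
      by (simp add: suminf_add)
    also have "\<dots> = (\<Sum>i. emeasure M (A' i) * emeasure N (B' i))"
    proof (rule suminf_cong)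
      fix i
      have N: "emeasure N (B' i) = emeasure N (B' i \<inter> B) + emeasure N (B' i - B)"
        using m B by (subst plus_emeasure) (auto intro!: arg_cong[where f="emeasure N"])
      have M: "emeasure M (A' i) = emeasure M (A' i \<inter> A) + emeasure M (A' i - A)"
        using m A by (subst plus_emeasure) (auto intro!: arg_cong[where f="emeasure M"])
      show "emeasure M (A' i \<inter> A) * emeasure N (B' i \<inter> B) +
          (emeasure M (A' i - A) * emeasure N (B' i) +
           emeasure M (A' i \<inter> A) * emeasure N (B' i - B)) = emeasure M (A' i) * emeasure N (B' i)"
        unfolding M N by (simp add: algebra_simps)
    qed
    finally show ?thesis .
  qed
  then show ?thesis
    unfolding rect_outer_def[of M N E] by (intro Inf_greatest) auto
qed

lemma emeasure_caratheodory_prod: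
  assumes E: "E \<in> sets (M \<Otimes>\<^sub>M N)"
  shows "emeasure (caratheodory_prod M N) E = rect_outer M N E"
proof -
  let ?\<Omega> = "space M \<times> space N"
  let ?f = "rect_outer M N"
  let ?R = "{A \<times> B | A B. A \<in> sets M \<and> B \<in> sets N}"
  let ?L = "lambda_system ?\<Omega> (Pow ?\<Omega>) ?f"
  interpret P: sigma_algebra ?\<Omega> "Pow ?\<Omega>" by (rule sigma_algebra_Pow)
  have "outer_measure_space (Pow ?\<Omega>) ?f"
    unfolding outer_measure_space_def positive_def increasing_def countably_subadditive_def
    by (auto simp: rect_outer_empty rect_outer_countably_subadditive intro: rect_outer_mono)
  from P.caratheodory_lemma[OF this] have ms: "measure_space ?\<Omega> ?L ?f" .
  have "?R \<subseteq> ?L"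
  proof (clarsimp simp: P.lambda_system_eq, intro conjI ballI allI impI)
    fix A B assume AB: "A \<in> sets M" "B \<in> sets N"
    then show "A \<times> B \<subseteq> ?\<Omega>" by (auto dest: sets.sets_into_space)
    fix E
    show "?f (E \<inter> A \<times> B) + ?f (E - A \<times> B) = ?f E"
      using rect_outer_split[OF AB, of E] rect_outer_add[of M N "E \<inter> A \<times> B" "E - A \<times> B"]
      by (simp add: Int_Diff_Un antisym)
  qed
  then have sub: "sigma_sets ?\<Omega> ?R \<subseteq> ?L"
    using ms by (intro sigma_algebra.sigma_sets_subset) (auto simp: measure_space_def)
  have sets: "sets (caratheodory_prod M N) = sigma_sets ?\<Omega> ?R"
    by (simp add: sets_caratheodory_prod sets_pair_measure)
  show ?thesis
  proof (rule emeasure_measure_of[OF caratheodory_prod_def])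
    show "?R \<subseteq> Pow ?\<Omega>" by (auto dest: sets.sets_into_space)
    show "E \<in> sets (caratheodory_prod M N)" using E by (simp add: sets_caratheodory_prod)
    show "positive (sets (caratheodory_prod M N)) ?f"
      by (simp add: positive_def rect_outer_empty)
    show "countably_additive (sets (caratheodory_prod M N)) ?f"
      using ms sub unfolding sets measure_space_def countably_additive_def by blast
  qed
qed

lemma caratheodory_prod_eq_pair_measure:
  assumes "sigma_finite_measure M" "sigma_finite_measure N"
  shows "caratheodory_prod M N = M \<Otimes>\<^sub>M N"
  using assms
  by (intro pair_measure_eqI[symmetric])
     (simp_all add: sets_caratheodory_prod emeasure_caratheodory_prod rect_outer_rectangle)

abbreviation Rplus :: "real measure" where
  "Rplus \<equiv> lebesgue_on {0<..}"

text \<open>\<open>real_of_ereal\<close> only makes the norm real-valued: on \<open>Linfty_space P\<close> the essential supremum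
  is finite, except that it is \<open>-\<infinity>\<close> (giving norm 0) when \<open>P\<close> is the zero measure.\<close>

definition Linfty_space :: "'a measure \<Rightarrow> ('a \<Rightarrow> real) set" where
  "Linfty_space P = {f \<in> borel_measurable P. esssup P (\<lambda>z. ereal \<bar>f z\<bar>) < \<infinity>}"

definition Linfty_norm :: "'a measure \<Rightarrow> ('a \<Rightarrow> real) \<Rightarrow> real" where
  "Linfty_norm P f = real_of_ereal (esssup P (\<lambda>z. ereal \<bar>f z\<bar>))"

text \<open>All data being non-negative, the iterated integral is taken as a non-negative one with values
  in \<open>[0,\<infinity>]\<close>; the equation forces it to be finite almost everywhere. For sigma-finite
  \<open>M\<close> the inner integral is measurable in \<open>s\<close>; otherwise the outer one may be a lower integral,
  which only admits more candidate solutions.\<close>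

definition nonneg_Linfty_solution ::
    "'a measure \<Rightarrow> ('a \<times> 'a \<times> real \<Rightarrow> real) \<Rightarrow> ('a \<times> real \<Rightarrow> real) \<Rightarrow> ('a \<times> real \<Rightarrow> real) \<Rightarrow>
     (real \<Rightarrow> real) \<Rightarrow> ('a \<times> real \<Rightarrow> real) \<Rightarrow> bool" where
  "nonneg_Linfty_solution M K g h G u \<longleftrightarrow>
     u \<in> Linfty_space (caratheodory_prod M Rplus) \<and>
     (AE z in caratheodory_prod M Rplus. 0 \<le> u z) \<and>
     (AE (x, t) in caratheodory_prod M Rplus.
        ennreal (u (x, t)) = ennreal (g (x, t)) +
          (\<integral>\<^sup>+ s\<in>{0<..<t}. (\<integral>\<^sup>+ y. ennreal (K (x, y, t - s) * h (y, s) * G (u (y, s))) \<partial>M) \<partial>lebesgue))"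

end

theory Submission
  imports Defs
begin

text \<open>
  The proof is a contraction argument for the order on non-negative functions. A concave \<open>G\<close> with
  \<open>G 0 = 0\<close> satisfies \<open>G (\<sigma> v + (1 - \<sigma>) d) \<ge> \<sigma> G v + (1 - \<sigma>) G d\<close>, in particular
  \<open>G (\<sigma> v) \<ge> \<sigma> G v\<close>. Let \<open>u\<close> and \<open>v\<close> be solutions with \<open>\<sigma> v \<le> u\<close>. Inserting this into the equation
  gives \<open>u \<ge> \<sigma> v + (1 - \<sigma>) g\<close>, hence \<open>u \<ge> \<sigma> v + (1 - \<sigma>) \<beta>0\<close> at times \<open>t < T0\<close>. Inserting the latter
  once more gives, at times \<open>t \<ge> T0\<close>, \<open>u \<ge> \<sigma> v + (1 - \<sigma>) G \<beta>0 (\<integral> p1)\<close> with the integral over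
  \<open>(0, T0)\<close>, because \<open>\<integral> K = 1\<close> and \<open>p1 \<le> h\<close>. So \<open>u \<ge> \<sigma> v + (1 - \<sigma>) \<kappa>\<close> for a constant \<open>\<kappa> > 0\<close>
  independent of \<open>\<sigma>\<close> (\<open>solution_superlinear\<close>).

  Every solution is at most \<open>\<xi>\<close>: its norm \<open>W\<close> satisfies \<open>W \<le> \<parallel>g\<parallel> + G W\<close> since \<open>\<integral> p2 = 1\<close>, that is
  \<open>W - G W \<le> \<xi> - G \<xi>\<close>, and \<open>w - G w\<close> is convex, zero at \<open>0\<close> and positive at \<open>\<xi>\<close>
  (\<open>solution_le\<close>, \<open>concave_sublevel_bound\<close>). Therefore \<open>\<kappa> \<ge> (\<kappa> / \<xi>) v\<close>, and \<open>\<sigma>\<close> improves to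
  \<open>\<sigma> + (1 - \<sigma>) \<kappa> / \<xi>\<close>. Starting from \<open>\<sigma> = 0\<close> the factors tend to \<open>1\<close>, so \<open>v \<le> u\<close>, and by symmetry
  \<open>u = v\<close> (\<open>solution_ge_solution\<close>).

  As \<open>M\<close> need not be sigma-finite, two points replace Tonelli's theorem. Null sets of
  \<open>caratheodory_prod\<close> have null sections in both directions (\<open>AE_caratheodory_prod_sections\<close>), so a.e.
  inequalities may be used under the iterated integral. The integrand of the outer integral may be
  non-measurable, but lower integrals are still superlinear (\<open>nn_integral_superlinear\<close>).
\<close>

section \<open>Lower integrals and almost-everywhere statements\<close>

text \<open>The integral of an arbitrary function, being a supremum over simple minorants, is attained by
  a measurable minorant.\<close>

lemma nn_integral_attained_below:
  fixes f :: "'a \<Rightarrow> ennreal"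
  obtains F where "F \<in> borel_measurable M" "F \<le> f" "(\<integral>\<^sup>+x. F x \<partial>M) = (\<integral>\<^sup>+x. f x \<partial>M)"
proof -
  let ?A = "{g. simple_function M g \<and> g \<le> f}"
  have "(\<lambda>_. 0) \<in> ?A" by (auto simp: le_fun_def)
  then have "?A \<noteq> {}" by blast
  from ennreal_SUP_countable_SUP[OF this, of "integral\<^sup>S M"]
  obtain h where h: "range h \<subseteq> integral\<^sup>S M ` ?A" "(\<integral>\<^sup>+x. f x \<partial>M) = (SUP i::nat. h i)"
    unfolding nn_integral_def by blast
  from h(1) have "\<forall>i. \<exists>g. g \<in> ?A \<and> h i = integral\<^sup>S M g"
    by (simp add: subset_eq image_iff)
  then obtain g where g: "\<And>i. g i \<in> ?A" "\<And>i. h i = integral\<^sup>S M (g i)"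
    by metis
  define F where "F x = (SUP i. g i x)" for x
  have meas: "F \<in> borel_measurable M"
    unfolding F_def using g(1) by (intro borel_measurable_SUP borel_measurable_simple_function) auto
  have le: "F \<le> f"
    unfolding F_def using g(1) by (auto simp: le_fun_def intro!: SUP_least)
  have "(\<integral>\<^sup>+x. f x \<partial>M) \<le> (\<integral>\<^sup>+x. F x \<partial>M)"
    unfolding h(2)
  proof (rule SUP_least)
    fix i
    have "h i = (\<integral>\<^sup>+x. g i x \<partial>M)"
      using g by (simp add: nn_integral_eq_simple_integral)
    also have "\<dots> \<le> (\<integral>\<^sup>+x. F x \<partial>M)"
      unfolding F_def by (intro nn_integral_mono SUP_upper) auto
    finally show "h i \<le> (\<integral>\<^sup>+x. F x \<partial>M)" .
  qed
  moreover have "(\<integral>\<^sup>+x. F x \<partial>M) \<le> (\<integral>\<^sup>+x. f x \<partial>M)"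
    using le by (intro nn_integral_mono) (auto simp: le_fun_def)
  ultimately show thesis
    using that meas le by (simp add: antisym)
qed

text \<open>Only the additive perturbation \<open>c\<close> has to be measurable here; for arbitrary \<open>f\<close> and \<open>F\<close>
  the integrals are lower integrals.\<close>

lemma nn_integral_superlinear:
  fixes f F c :: "'a \<Rightarrow> ennreal"
  assumes c: "c \<in> borel_measurable M" and le: "AE x in M. a * f x + c x \<le> F x"
  shows "a * (\<integral>\<^sup>+x. f x \<partial>M) + (\<integral>\<^sup>+x. c x \<partial>M) \<le> (\<integral>\<^sup>+x. F x \<partial>M)"
proof -
  obtain f' where f': "f' \<in> borel_measurable M" "f' \<le> f"
      "(\<integral>\<^sup>+x. f' x \<partial>M) = (\<integral>\<^sup>+x. f x \<partial>M)"
    using nn_integral_attained_below .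
  have "a * (\<integral>\<^sup>+x. f x \<partial>M) + (\<integral>\<^sup>+x. c x \<partial>M) = (\<integral>\<^sup>+x. a * f' x + c x \<partial>M)"
    using c f'(1) by (simp add: nn_integral_add nn_integral_cmult f'(3)[symmetric])
  also have "\<dots> \<le> (\<integral>\<^sup>+x. F x \<partial>M)"
  proof (rule nn_integral_mono_AE)
    show "AE x in M. a * f' x + c x \<le> F x"
      using le
    proof eventually_elim
      fix x assume "a * f x + c x \<le> F x"
      moreover have "a * f' x \<le> a * f x"
        using f'(2) by (intro mult_left_mono) (auto simp: le_fun_def)
      ultimately show "a * f' x + c x \<le> F x"
        by (meson add_right_mono order_trans)
    qed
  qed
  finally show ?thesis .
qed

text \<open>Each rectangle cover of \<open>E\<close> bounds the section measure by a measurable function of \<open>y\<close> whose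
  integral is the total area of the cover. Choosing covers of area below \<open>1 / Suc n\<close>, the infimum
  of these bounds over \<open>n\<close> has integral zero.\<close>

lemma AE_section_null_of_rect_outer:
  assumes E: "E \<in> sets (M \<Otimes>\<^sub>M N)" and 0: "rect_outer M N E = 0"
  shows "AE y in N. AE x in M. (x, y) \<notin> E"
proof -
  have "\<exists>f. f \<in> borel_measurable N \<and> (\<integral>\<^sup>+y. f y \<partial>N) < ennreal (1 / Suc n) \<and>
          (\<forall>y. emeasure M ((\<lambda>x. (x, y)) -` E) \<le> f y)" for n
  proof -
    have "rect_outer M N E < ennreal (1 / Suc n)" using 0 by simp
    from rect_outer_close[OF this] obtain A B where AB: "\<And>i::nat. A i \<in> sets M"
      "\<And>i. B i \<in> sets N" "E \<subseteq> (\<Union>i. A i \<times> B i)"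
      "(\<Sum>i. emeasure M (A i) * emeasure N (B i)) < ennreal (1 / Suc n)" by blast
    let ?f = "\<lambda>y. \<Sum>i. emeasure M (A i) * indicator (B i) y"
    have "(\<integral>\<^sup>+y. ?f y \<partial>N) = (\<Sum>i. \<integral>\<^sup>+y. emeasure M (A i) * indicator (B i) y \<partial>N)"
      using AB by (intro nn_integral_suminf) auto
    also have "\<dots> = (\<Sum>i. emeasure M (A i) * emeasure N (B i))"
      using AB by (simp add: nn_integral_cmult_indicator)
    finally have int: "(\<integral>\<^sup>+y. ?f y \<partial>N) < ennreal (1 / Suc n)" using AB(4) by simp
    have "emeasure M ((\<lambda>x. (x, y)) -` E) \<le> ?f y" for y
    proof -
      let ?C = "\<lambda>i. if y \<in> B i then A i else {}"
      have "emeasure M ((\<lambda>x. (x, y)) -` E) \<le> emeasure M (\<Union>i. ?C i)"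
        using AB by (intro emeasure_mono) (fastforce, auto)
      also have "\<dots> \<le> (\<Sum>i. emeasure M (?C i))"
        using AB by (intro emeasure_subadditive_countably) auto
      also have "\<dots> = ?f y" by (intro suminf_cong) auto
      finally show ?thesis .
    qed
    with int show ?thesis using AB by (intro exI[of _ ?f]) auto
  qed
  then obtain f where f: "\<And>n. f n \<in> borel_measurable N"
    "\<And>n. (\<integral>\<^sup>+y. f n y \<partial>N) < ennreal (1 / Suc n)"
    "\<And>n y. emeasure M ((\<lambda>x. (x, y)) -` E) \<le> f n y" by metis
  have "(\<integral>\<^sup>+y. (INF n. f n y) \<partial>N) \<le> ennreal (1 / Suc n)" for n
    using f(2)[of n] by (meson INF_lower UNIV_I less_imp_le nn_integral_mono order_trans)
  moreover have "(\<lambda>n. ennreal (1 / Suc n)) \<longlonglongrightarrow> ennreal 0"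
    by (rule tendsto_ennrealI[OF LIMSEQ_Suc[OF lim_1_over_n]])
  ultimately have "(\<integral>\<^sup>+y. (INF n. f n y) \<partial>N) = 0"
    by (intro antisym LIMSEQ_le_const) auto
  then have "AE y in N. (INF n. f n y) = 0"
    using f(1) by (subst nn_integral_0_iff_AE[symmetric]) auto
  then show ?thesis
    using AE_space
  proof eventually_elim
    fix y assume y: "(INF n. f n y) = 0" "y \<in> space N"
    have "emeasure M ((\<lambda>x. (x, y)) -` E) \<le> (INF n. f n y)"
      using f(3) by (intro INF_greatest)
    then have "(\<lambda>x. (x, y)) -` E \<in> null_sets M"
      using y sets_Pair2[OF E, of y] by auto
    from AE_not_in[OF this] show "AE x in M. (x, y) \<notin> E" by simp
  qed
qed

lemma rect_outer_swap_le: "rect_outer N M (prod.swap -` E) \<le> rect_outer M N E"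
proof -
  have "rect_outer N M (prod.swap -` E) \<le> (\<Sum>i. emeasure M (A i) * emeasure N (B i))"
    if A: "range A \<subseteq> sets M" and B: "range B \<subseteq> sets N"
      and cover: "E \<subseteq> (\<Union>i::nat. A i \<times> B i)" for A B
  proof -
    have "prod.swap -` E \<subseteq> (\<Union>i. B i \<times> A i)"
    proof
      fix z assume "z \<in> prod.swap -` E"
      then have "prod.swap z \<in> E" by (rule vimageD)
      from subsetD[OF cover this] obtain i where "prod.swap z \<in> A i \<times> B i" by (rule UN_E)
      then have "z \<in> B i \<times> A i" by (cases z) simp
      then show "z \<in> (\<Union>i. B i \<times> A i)" by (rule UN_I[OF UNIV_I])
    qed
    from rect_outer_le[OF _ _ this, of N M] show ?thesis
      using A B by (simp add: image_subset_iff mult.commute)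
  qed
  then show ?thesis
    unfolding rect_outer_def[of M N] by (intro Inf_greatest) auto
qed

text \<open>Fubini's theorem for null sets. It holds in both orders and without sigma-finiteness.\<close>

lemma AE_caratheodory_prod_sections:
  assumes "AE z in caratheodory_prod M N. Q z"
  shows "AE y in N. AE x in M. Q (x, y)" "AE x in M. AE y in N. Q (x, y)"
proof -
  obtain E where E: "E \<in> null_sets (caratheodory_prod M N)"
    "{z \<in> space (caratheodory_prod M N). \<not> Q z} \<subseteq> E"
    using assms unfolding eventually_ae_filter by blast
  have sE: "E \<in> sets (M \<Otimes>\<^sub>M N)" using E(1) by (auto simp: sets_caratheodory_prod)
  have rE: "rect_outer M N E = 0"
    using E(1) emeasure_caratheodory_prod[OF sE] by auto
  have sub: "Q (x, y)" if "x \<in> space M" "y \<in> space N" "(x, y) \<notin> E" for x y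
    using E(2) that by (auto simp: space_caratheodory_prod)
  have "AE y in N. AE x in M. (x, y) \<notin> E"
    by (rule AE_section_null_of_rect_outer[OF sE rE])
  then show "AE y in N. AE x in M. Q (x, y)"
    using AE_space
  proof eventually_elim
    case (elim y)
    from elim(1) AE_space show ?case
      by eventually_elim (use elim sub in auto)
  qed
  let ?E' = "prod.swap -` E"
  have "(\<lambda>(y, x). (x, y)) -` E \<inter> space (N \<Otimes>\<^sub>M M) \<in> sets (N \<Otimes>\<^sub>M M)"
    by (rule measurable_sets[OF measurable_pair_swap' sE])
  moreover have "?E' = (\<lambda>(y, x). (x, y)) -` E \<inter> space (N \<Otimes>\<^sub>M M)"
    using sets.sets_into_space[OF sE] by (auto simp: space_pair_measure)
  ultimately have sE': "?E' \<in> sets (N \<Otimes>\<^sub>M M)" by simp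
  have "rect_outer N M ?E' = 0" using rect_outer_swap_le[of N M E] rE by simp
  from AE_section_null_of_rect_outer[OF sE' this]
  have "AE x in M. AE y in N. (x, y) \<notin> E" by simp
  then show "AE x in M. AE y in N. Q (x, y)"
    using AE_space
  proof eventually_elim
    case (elim x)
    from elim(1) AE_space show ?case
      by eventually_elim (use elim sub in auto)
  qed
qed

text \<open>A cylinder over a null set is a null rectangle, since \<open>0 * \<infinity> = 0\<close>.\<close>

lemma AE_caratheodory_prod_fst:
  assumes "AE x in M. Q x"
  shows "AE z in caratheodory_prod M N. Q (fst z)"
proof -
  obtain E where E: "E \<in> null_sets M" "{x \<in> space M. \<not> Q x} \<subseteq> E"
    using assms unfolding eventually_ae_filter by blast
  have sE: "E \<in> sets M" "E \<times> space N \<in> sets (M \<Otimes>\<^sub>M N)" using E(1) by auto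
  have "E \<times> space N \<in> null_sets (caratheodory_prod M N)"
    using E(1) sE emeasure_caratheodory_prod[OF sE(2)] rect_outer_rectangle[OF sE(1) sets.top, of N]
    by (intro null_setsI) (auto simp: sets_caratheodory_prod)
  then show ?thesis
    using E(2) by (intro AE_I'[of "E \<times> space N"]) (auto simp: space_caratheodory_prod)
qed

lemma AE_Rplus_iff: "(AE t in Rplus. Q t) \<longleftrightarrow> (AE t in lebesgue. 0 < t \<longrightarrow> Q t)"
  by (subst AE_restrict_space_iff) (auto simp: fmeasurableD)

lemma borel_measurable_Rplus_cutoff:
  fixes p :: "real \<Rightarrow> real"
  assumes "p \<in> borel_measurable Rplus"
  shows "(\<lambda>s. ennreal (p s) * indicator {0<..<b} s) \<in> borel_measurable lebesgue"
proof -
  have "(\<lambda>s. ennreal (p s) * indicator {0<..} s) \<in> borel_measurable lebesgue"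
    using assms by (subst borel_measurable_restrict_space_iff_ennreal[symmetric]) auto
  then have "(\<lambda>s. (ennreal (p s) * indicator {0<..} s) * indicator {..<b} s)
      \<in> borel_measurable lebesgue"
    by (rule borel_measurable_times_ennreal) (auto intro!: borel_measurable_indicator)
  also have "(\<lambda>s. (ennreal (p s) * indicator {0<..} s) * indicator {..<b} s) =
      (\<lambda>s. ennreal (p s) * indicator {0<..<b} s)"
    by (auto simp: fun_eq_iff indicator_def)
  finally show ?thesis .
qed

lemma not_AE_notin_interval:
  fixes a b :: real
  assumes "a < b"
  shows "\<not> (AE t in lebesgue. t \<notin> {a<..<b})"
proof
  assume "AE t in lebesgue. t \<notin> {a<..<b}"
  then have "{a<..<b} \<in> null_sets lebesgue" by (subst AE_iff_null_sets) auto
  then have "emeasure lebesgue {a<..<b} = 0" by (rule null_setsD1)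
  with assms show False by simp
qed

lemma AE_lebesgue_reflect:
  fixes t :: real
  assumes "AE r in lebesgue. Q r"
  shows "AE s in lebesgue. Q (t - s)"
proof -
  have "AE r in lborel. Q r" using assms by (simp add: AE_completion_iff)
  then obtain E where E: "E \<in> null_sets lborel" "{x \<in> space lborel. \<not> Q x} \<subseteq> E"
    unfolding eventually_ae_filter by blast
  have "AE r in lborel. r \<notin> E" using E(1) by (rule AE_not_in)
  then have "AE s in lborel. t + (-1) * s \<notin> E"
    using E(1) by (intro AE_borel_affine) (auto intro!: pred_intros_logic)
  then have "AE s in lborel. Q (t - s)"
    by (rule AE_mp) (use E(2) in \<open>auto intro!: AE_I2\<close>)
  then show ?thesis by (rule AE_completion)
qed

text \<open>The zero measure is excluded: its essential suprema are \<open>-\<infinity>\<close> and are turned into norm \<open>0\<close>,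
  so the second statement would fail for negative \<open>c\<close>.\<close>

lemma
  assumes f: "f \<in> Linfty_space P" and P: "emeasure P (space P) \<noteq> 0"
  shows AE_le_Linfty_norm: "AE z in P. \<bar>f z\<bar> \<le> Linfty_norm P f"
    and Linfty_norm_le: "(AE z in P. \<bar>f z\<bar> \<le> c) \<Longrightarrow> Linfty_norm P f \<le> c"
proof -
  let ?e = "esssup P (\<lambda>z. ereal \<bar>f z\<bar>)"
  have meas: "(\<lambda>z. ereal \<bar>f z\<bar>) \<in> borel_measurable P" and "?e \<noteq> \<infinity>"
    using f by (auto simp: Linfty_space_def)
  have ae: "AE z in P. ereal \<bar>f z\<bar> \<le> ?e" by (rule esssup_AE)
  have "?e \<noteq> -\<infinity>"
  proof
    assume "?e = -\<infinity>"
    with ae have "AE z in P. False" by simp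
    with P show False by (simp add: ae_filter_eq_bot_iff[symmetric] trivial_limit_def)
  qed
  with \<open>?e \<noteq> \<infinity>\<close> have e: "?e = ereal (Linfty_norm P f)"
    unfolding Linfty_norm_def by (cases ?e) auto
  show "AE z in P. \<bar>f z\<bar> \<le> Linfty_norm P f" using ae unfolding e by simp
  assume "AE z in P. \<bar>f z\<bar> \<le> c"
  then have "?e \<le> ereal c" using meas by (intro esssup_I) auto
  then show "Linfty_norm P f \<le> c" unfolding e by simp
qed

section \<open>The integral operator\<close>

text \<open>The right-hand side of the integral equation without the inhomogeneity \<open>g\<close>.\<close>

definition memory_term ::
    "'a measure \<Rightarrow> ('a \<times> 'a \<times> real \<Rightarrow> real) \<Rightarrow> ('a \<times> real \<Rightarrow> real) \<Rightarrow> (real \<Rightarrow> real) \<Rightarrow>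
     ('a \<times> real \<Rightarrow> real) \<Rightarrow> 'a \<Rightarrow> real \<Rightarrow> ennreal" where
  "memory_term M K h G u x t =
     (\<integral>\<^sup>+ s\<in>{0<..<t}. (\<integral>\<^sup>+ y. ennreal (K (x, y, t - s) * h (y, s) * G (u (y, s))) \<partial>M) \<partial>lebesgue)"

lemma concave_on_scale_lower:
  fixes G :: "real \<Rightarrow> real"
  assumes "concave_on {0..} G" "mono_on {0..} G" "0 \<le> v" "0 \<le> d" "0 \<le> \<sigma>" "\<sigma> \<le> 1"
    and "\<sigma> * v + (1 - \<sigma>) * d \<le> u"
  shows "\<sigma> * G v + (1 - \<sigma>) * G d \<le> G u"
proof -
  have "\<sigma> * G v + (1 - \<sigma>) * G d \<le> G (\<sigma> * v + (1 - \<sigma>) * d)"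
    using concave_onD[OF assms(1), of \<sigma> d v] assms by (simp add: algebra_simps)
  also have "\<dots> \<le> G u"
  proof (rule mono_onD[OF assms(2)])
    show "\<sigma> * v + (1 - \<sigma>) * d \<in> {0..}" using assms by simp
    then show "u \<in> {0..}" using assms(7) by simp
  qed (rule assms(7))
  finally show ?thesis .
qed

text \<open>Let \<open>w\<close> be the function equal to \<open>d\<close> before time \<open>T\<close> and to \<open>0\<close> afterwards. If
  \<open>u \<ge> \<sigma> v + (1 - \<sigma>) w\<close>, then concavity and monotonicity of \<open>G\<close> give the same inequality between
  the images under the operator, and the image of \<open>w\<close> is bounded below through \<open>\<integral> K = 1\<close> and
  \<open>p \<le> h\<close>. Neither \<open>h\<close>, \<open>u\<close> nor \<open>v\<close> has to be measurable.\<close>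

lemma memory_term_superlinear:
  fixes \<sigma> d T :: real
  assumes G: "concave_on {0..} G" "mono_on {0..} G" "G 0 = 0"
    and \<sigma>: "0 \<le> \<sigma>" "\<sigma> \<le> 1" and d: "0 \<le> d"
    and K_meas: "\<And>r. 0 < r \<Longrightarrow> (\<lambda>y. K (x, y, r)) \<in> borel_measurable M"
    and K_nonneg: "\<And>y r. y \<in> space M \<Longrightarrow> 0 < r \<Longrightarrow> 0 \<le> K (x, y, r)"
    and K_int: "AE r in lebesgue. 0 < r \<longrightarrow> (\<integral>\<^sup>+ y. ennreal (K (x, y, r)) \<partial>M) = 1"
    and p: "p \<in> borel_measurable Rplus" "\<And>s. 0 < s \<Longrightarrow> 0 \<le> p s"
    and cmp: "AE s in lebesgue. 0 < s \<longrightarrow> (AE y in M. 0 \<le> v (y, s) \<and> p s \<le> h (y, s) \<and>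
                \<sigma> * v (y, s) + (1 - \<sigma>) * (if s < T then d else 0) \<le> u (y, s))"
  shows "ennreal \<sigma> * memory_term M K h G v x t +
           ennreal ((1 - \<sigma>) * G d) * (\<integral>\<^sup>+ s. ennreal (p s) * indicator {0<..<min t T} s \<partial>lebesgue)
         \<le> memory_term M K h G u x t"
proof -
  have G_nonneg: "0 \<le> G w" if "0 \<le> w" for w
    using mono_onD[OF G(2), of 0 w] G(3) that by simp
  let ?J = "\<lambda>w s. \<integral>\<^sup>+ y. ennreal (K (x, y, t - s) * h (y, s) * G (w (y, s))) \<partial>M"
  let ?c = "\<lambda>s. ennreal (p s) * indicator {0<..<min t T} s"
  have c: "?c \<in> borel_measurable lebesgue"
    by (rule borel_measurable_Rplus_cutoff[OF p(1)])
  have "AE s in lebesgue. 0 < t - s \<longrightarrow> (\<integral>\<^sup>+ y. ennreal (K (x, y, t - s)) \<partial>M) = 1"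
    by (rule AE_lebesgue_reflect[OF K_int])
  \<comment> \<open>The inner integrals over \<open>y\<close> are compared first; there the measurable perturbation is a
    multiple of \<open>K\<close>, and its integral is known.\<close>
  with cmp have "AE s in lebesgue. ennreal \<sigma> * (?J v s * indicator {0<..<t} s) +
      ennreal ((1 - \<sigma>) * G d) * ?c s \<le> ?J u s * indicator {0<..<t} s"
  proof eventually_elim
    fix s
    assume K1: "0 < t - s \<longrightarrow> (\<integral>\<^sup>+ y. ennreal (K (x, y, t - s)) \<partial>M) = 1"
      and ae: "0 < s \<longrightarrow> (AE y in M. 0 \<le> v (y, s) \<and> p s \<le> h (y, s) \<and>
                \<sigma> * v (y, s) + (1 - \<sigma>) * (if s < T then d else 0) \<le> u (y, s))"
    show "ennreal \<sigma> * (?J v s * indicator {0<..<t} s) + ennreal ((1 - \<sigma>) * G d) * ?c s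
        \<le> ?J u s * indicator {0<..<t} s"
    proof (cases "0 < s \<and> s < t")
      case True
      define e where "e = (if s < T then d else 0)"
      have e: "0 \<le> e" using d by (simp add: e_def)
      let ?k = "\<lambda>y. ennreal (K (x, y, t - s))"
      let ?q = "ennreal ((1 - \<sigma>) * p s * G e)"
      have k: "?k \<in> borel_measurable M" using K_meas[of "t - s"] True by simp
      have "ennreal \<sigma> * ?J v s + (\<integral>\<^sup>+ y. ?q * ?k y \<partial>M) \<le> ?J u s"
      proof (rule nn_integral_superlinear)
        show "(\<lambda>y. ?q * ?k y) \<in> borel_measurable M" using k by simp
        from True ae have "AE y in M. 0 \<le> v (y, s) \<and> p s \<le> h (y, s) \<and>
                \<sigma> * v (y, s) + (1 - \<sigma>) * e \<le> u (y, s)" by (simp add: e_def)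
        then show "AE y in M. ennreal \<sigma> * ennreal (K (x, y, t - s) * h (y, s) * G (v (y, s))) + ?q * ?k y
            \<le> ennreal (K (x, y, t - s) * h (y, s) * G (u (y, s)))"
        proof (rule AE_mp, intro AE_I2 impI, elim conjE)
          fix y assume y: "y \<in> space M" and v: "0 \<le> v (y, s)" and ph: "p s \<le> h (y, s)"
            and le: "\<sigma> * v (y, s) + (1 - \<sigma>) * e \<le> u (y, s)"
          have K0: "0 \<le> K (x, y, t - s)" using K_nonneg[OF y] True by simp
          have p0: "0 \<le> p s" and h0: "0 \<le> h (y, s)" using p(2)[of s] ph True by auto
          have Ge: "0 \<le> (1 - \<sigma>) * G e" using G_nonneg[OF e] \<sigma> by simp
          have "\<sigma> * (h (y, s) * G (v (y, s))) + (1 - \<sigma>) * p s * G e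
              \<le> h (y, s) * (\<sigma> * G (v (y, s)) + (1 - \<sigma>) * G e)"
            using mult_right_mono[OF ph Ge] by (simp add: algebra_simps)
          also have "\<dots> \<le> h (y, s) * G (u (y, s))"
            by (rule mult_left_mono[OF concave_on_scale_lower[OF G(1,2) v e \<sigma> le] h0])
          finally have "K (x, y, t - s) * (\<sigma> * (h (y, s) * G (v (y, s))) + (1 - \<sigma>) * p s * G e)
              \<le> K (x, y, t - s) * (h (y, s) * G (u (y, s)))"
            using K0 by (rule mult_left_mono)
          then have "\<sigma> * (K (x, y, t - s) * h (y, s) * G (v (y, s))) + (1 - \<sigma>) * p s * G e * K (x, y, t - s)
              \<le> K (x, y, t - s) * h (y, s) * G (u (y, s))"
            by (simp add: algebra_simps)
          then show "ennreal \<sigma> * ennreal (K (x, y, t - s) * h (y, s) * G (v (y, s))) + ?q * ?k y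
            \<le> ennreal (K (x, y, t - s) * h (y, s) * G (u (y, s)))"
            using K0 h0 p0 \<sigma> G_nonneg[OF v] G_nonneg[OF e]
            by (simp add: ennreal_mult[symmetric] ennreal_plus[symmetric] ennreal_leI del: ennreal_plus)
        qed
      qed
      also have "(\<integral>\<^sup>+ y. ?q * ?k y \<partial>M) = ?q"
        using k K1 True by (simp add: nn_integral_cmult)
      \<comment> \<open>For \<open>s \<ge> T\<close> both sides vanish, because then \<open>e = 0\<close> and \<open>G 0 = 0\<close>.\<close>
      also have "?q = ennreal ((1 - \<sigma>) * G d) * ?c s"
        using True p(2)[of s] \<sigma> G(3) G_nonneg[OF d]
        by (auto simp: e_def ennreal_mult[symmetric] indicator_def ac_simps)
      finally show ?thesis using True by simp
    qed (auto simp: indicator_def)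
  qed
  from nn_integral_superlinear[OF _ this]
  have "ennreal \<sigma> * (\<integral>\<^sup>+ s. ?J v s * indicator {0<..<t} s \<partial>lebesgue) +
      (\<integral>\<^sup>+ s. ennreal ((1 - \<sigma>) * G d) * ?c s \<partial>lebesgue)
      \<le> (\<integral>\<^sup>+ s. ?J u s * indicator {0<..<t} s \<partial>lebesgue)"
    using c by simp
  then show ?thesis
    unfolding memory_term_def using c by (simp add: nn_integral_cmult)
qed

lemma memory_term_le:
  fixes U :: real
  assumes G: "mono_on {0..} G" "G 0 = 0" and U: "0 \<le> U"
    and K_meas: "\<And>r. 0 < r \<Longrightarrow> (\<lambda>y. K (x, y, r)) \<in> borel_measurable M"
    and K_nonneg: "\<And>y r. y \<in> space M \<Longrightarrow> 0 < r \<Longrightarrow> 0 \<le> K (x, y, r)"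
    and K_int: "AE r in lebesgue. 0 < r \<longrightarrow> (\<integral>\<^sup>+ y. ennreal (K (x, y, r)) \<partial>M) = 1"
    and p: "p \<in> borel_measurable Rplus" "\<And>s. 0 < s \<Longrightarrow> 0 \<le> p s"
    and cmp: "AE s in lebesgue. 0 < s \<longrightarrow>
                (AE y in M. 0 \<le> u (y, s) \<and> u (y, s) \<le> U \<and> h (y, s) \<le> p s)"
  shows "memory_term M K h G u x t \<le> ennreal (G U) * (\<integral>\<^sup>+ s. ennreal (p s) \<partial>Rplus)"
proof -
  have G_nonneg: "0 \<le> G w" if "0 \<le> w" for w
    using mono_onD[OF G(1), of 0 w] G(2) that by simp
  let ?J = "\<lambda>s. \<integral>\<^sup>+ y. ennreal (K (x, y, t - s) * h (y, s) * G (u (y, s))) \<partial>M"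
  let ?c = "\<lambda>s. ennreal (p s) * indicator {0<..} s"
  have c: "?c \<in> borel_measurable lebesgue"
    using p(1) by (subst borel_measurable_restrict_space_iff_ennreal[symmetric]) auto
  have "AE s in lebesgue. 0 < t - s \<longrightarrow> (\<integral>\<^sup>+ y. ennreal (K (x, y, t - s)) \<partial>M) = 1"
    by (rule AE_lebesgue_reflect[OF K_int])
  with cmp have "AE s in lebesgue. ?J s * indicator {0<..<t} s \<le> ennreal (G U) * ?c s"
  proof eventually_elim
    fix s
    assume K1: "0 < t - s \<longrightarrow> (\<integral>\<^sup>+ y. ennreal (K (x, y, t - s)) \<partial>M) = 1"
      and ae: "0 < s \<longrightarrow> (AE y in M. 0 \<le> u (y, s) \<and> u (y, s) \<le> U \<and> h (y, s) \<le> p s)"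
    show "?J s * indicator {0<..<t} s \<le> ennreal (G U) * ?c s"
    proof (cases "0 < s \<and> s < t")
      case True
      let ?k = "\<lambda>y. ennreal (K (x, y, t - s))"
      have k: "?k \<in> borel_measurable M" using K_meas[of "t - s"] True by simp
      have "?J s \<le> (\<integral>\<^sup>+ y. ennreal (p s * G U) * ?k y \<partial>M)"
      proof (rule nn_integral_mono_AE)
        from True ae have "AE y in M. 0 \<le> u (y, s) \<and> u (y, s) \<le> U \<and> h (y, s) \<le> p s" by simp
        then show "AE y in M. ennreal (K (x, y, t - s) * h (y, s) * G (u (y, s)))
            \<le> ennreal (p s * G U) * ?k y"
        proof (rule AE_mp, intro AE_I2 impI, elim conjE)
          fix y assume y: "y \<in> space M" and u: "0 \<le> u (y, s)" "u (y, s) \<le> U"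
            and h: "h (y, s) \<le> p s"
          have K0: "0 \<le> K (x, y, t - s)" using K_nonneg[OF y] True by simp
          have p0: "0 \<le> p s" using p(2)[of s] True by auto
          have "h (y, s) * G (u (y, s)) \<le> p s * G (u (y, s))"
            using h G_nonneg[OF u(1)] by (rule mult_right_mono)
          also have "\<dots> \<le> p s * G U"
            using u U p0 by (intro mult_left_mono[OF mono_onD[OF G(1)]]) simp_all
          finally have "K (x, y, t - s) * (h (y, s) * G (u (y, s))) \<le> K (x, y, t - s) * (p s * G U)"
            using K0 by (rule mult_left_mono)
          then have "K (x, y, t - s) * h (y, s) * G (u (y, s)) \<le> p s * G U * K (x, y, t - s)"
            by (simp add: ac_simps)
          then show "ennreal (K (x, y, t - s) * h (y, s) * G (u (y, s))) \<le> ennreal (p s * G U) * ?k y"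
            using K0 p0 G_nonneg[OF U] by (simp add: ennreal_mult'[symmetric] ennreal_leI)
        qed
      qed
      also have "\<dots> = ennreal (p s * G U)"
        using k K1 True by (simp add: nn_integral_cmult)
      also have "\<dots> = ennreal (G U) * ?c s"
        using True p(2)[of s] G_nonneg[OF U] by (simp add: ennreal_mult[symmetric] ac_simps)
      finally show ?thesis using True by simp
    qed simp
  qed
  then have "memory_term M K h G u x t \<le> (\<integral>\<^sup>+ s. ennreal (G U) * ?c s \<partial>lebesgue)"
    unfolding memory_term_def by (rule nn_integral_mono_AE)
  also have "\<dots> = ennreal (G U) * (\<integral>\<^sup>+ s. ennreal (p s) \<partial>Rplus)"
    using c by (simp add: nn_integral_cmult nn_integral_restrict_space)
  finally show ?thesis .
qed

section \<open>Comparison of solutions\<close>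

text \<open>A normalized non-negative kernel together with a concave increasing nonlinearity. The data
  \<open>g\<close> and \<open>h\<close> enter the lemmas only through a.e. bounds.\<close>

locale volterra_kernel =
  fixes M :: "'a measure" and K :: "'a \<times> 'a \<times> real \<Rightarrow> real" and G :: "real \<Rightarrow> real"
  assumes K_meas: "K \<in> borel_measurable (M \<Otimes>\<^sub>M M \<Otimes>\<^sub>M Rplus)"
    and K_nonneg: "\<forall>x\<in>space M. \<forall>y\<in>space M. \<forall>t>0. 0 \<le> K (x, y, t)"
    and K_int: "AE (x, t) in caratheodory_prod M Rplus. (\<integral>\<^sup>+ y. ennreal (K (x, y, t)) \<partial>M) = 1"
    and G_conc: "concave_on {0..} G"
    and G_mono: "mono_on {0..} G"
    and G_0: "G 0 = 0"
begin

abbreviation "P \<equiv> caratheodory_prod M Rplus"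

lemma G_nonneg: "0 \<le> w \<Longrightarrow> 0 \<le> G w"
  using mono_onD[OF G_mono, of 0 w] G_0 by simp

lemma K_section_measurable:
  assumes "x \<in> space M" "0 < r"
  shows "(\<lambda>y. K (x, y, r)) \<in> borel_measurable M"
proof -
  have "(\<lambda>y. (x, y, r)) \<in> measurable M (M \<Otimes>\<^sub>M M \<Otimes>\<^sub>M Rplus)"
    using assms by (intro measurable_Pair measurable_const measurable_ident) (auto simp: space_restrict_space)
  from measurable_compose[OF this K_meas] show ?thesis .
qed

lemma AE_slice:
  assumes "AE z in P. Q z"
  shows "AE s in lebesgue. 0 < s \<longrightarrow> (AE y in M. Q (y, s))"
  using AE_caratheodory_prod_sections(1)[OF assms] by (simp only: AE_Rplus_iff)

text \<open>For a.e. \<open>x\<close> the normalization holds at a.e. time; the exceptional set does not depend on the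
  second component of \<open>z\<close>. This is what makes the time-shifted kernel \<open>K (x, y, t - s)\<close>
  normalized for a.e. \<open>s\<close>.\<close>

lemma AE_kernel_normalized:
  "AE z in P. AE r in lebesgue. 0 < r \<longrightarrow> (\<integral>\<^sup>+ y. ennreal (K (fst z, y, r)) \<partial>M) = 1"
  using AE_caratheodory_prod_fst[OF AE_caratheodory_prod_sections(2)[OF K_int]]
  by (simp only: AE_Rplus_iff prod.case)

lemma AE_in_space: "AE z in P. fst z \<in> space M \<and> 0 < snd z"
  using AE_space by eventually_elim (auto simp: space_caratheodory_prod space_restrict_space)

lemma solution_eq:
  assumes "nonneg_Linfty_solution M K g h G u"
  shows "AE z in P. ennreal (u z) = ennreal (g z) + memory_term M K h G u (fst z) (snd z)"
proof -
  have "AE (x, t) in P. ennreal (u (x, t)) = ennreal (g (x, t)) + memory_term M K h G u x t"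
    using assms unfolding nonneg_Linfty_solution_def memory_term_def by simp
  then show ?thesis by (simp add: split_def)
qed

lemma solution_le:
  assumes u: "nonneg_Linfty_solution M K g h G u" and U: "AE z in P. u z \<le> U" "0 \<le> U"
    and p: "p \<in> borel_measurable Rplus" "\<And>s. 0 < s \<Longrightarrow> 0 \<le> p s"
      "(\<integral>\<^sup>+ s. ennreal (p s) \<partial>Rplus) \<le> 1"
    and h: "AE z in P. h z \<le> p (snd z)" and g: "AE z in P. g z \<le> N" "0 \<le> N"
  shows "AE z in P. u z \<le> N + G U"
proof -
  have "AE z in P. 0 \<le> u z" using u by (simp add: nonneg_Linfty_solution_def)
  with U(1) h have "AE z in P. 0 \<le> u z \<and> u z \<le> U \<and> h z \<le> p (snd z)"
    by eventually_elim simp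
  from AE_slice[OF this]
  have slice: "AE s in lebesgue. 0 < s \<longrightarrow>
      (AE y in M. 0 \<le> u (y, s) \<and> u (y, s) \<le> U \<and> h (y, s) \<le> p s)" by simp
  show ?thesis
    using solution_eq[OF u] AE_in_space AE_kernel_normalized g(1)
  proof eventually_elim
    case (elim z)
    have "memory_term M K h G u (fst z) (snd z) \<le> ennreal (G U) * (\<integral>\<^sup>+ s. ennreal (p s) \<partial>Rplus)"
      using elim K_nonneg
      by (intro memory_term_le[OF G_mono G_0 U(2) _ _ _ p(1,2) slice] K_section_measurable) auto
    also have "\<dots> \<le> ennreal (G U)"
      using mult_left_mono[OF p(3), of "ennreal (G U)"] by simp
    finally have "ennreal (u z) \<le> ennreal N + ennreal (G U)"
      unfolding elim(1) using elim(4) by (intro add_mono ennreal_leI)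
    also have "\<dots> = ennreal (N + G U)"
      using g(2) G_nonneg[OF U(2)] by simp
    finally show ?case
      using g(2) G_nonneg[OF U(2)] by (simp del: ennreal_plus)
  qed
qed

text \<open>The bound \<open>d\<close> on the surplus \<open>u - \<sigma> v\<close>, relative to \<open>1 - \<sigma>\<close> and at times before \<open>T\<close>,
  becomes a bound at times after \<open>T\<close>, while \<open>g\<close> is gained at all times.\<close>

lemma solution_superlinear:
  assumes u: "nonneg_Linfty_solution M K g h G u" and v: "nonneg_Linfty_solution M K g h G v"
    and g: "AE z in P. 0 \<le> g z"
    and p: "p \<in> borel_measurable Rplus" "\<And>s. 0 < s \<Longrightarrow> 0 \<le> p s"
    and h: "AE z in P. p (snd z) \<le> h z"
    and c: "0 \<le> c" "ennreal c \<le> (\<integral>\<^sup>+ s. ennreal (p s) * indicator {0<..<T} s \<partial>lebesgue)"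
    and \<sigma>: "0 \<le> \<sigma>" "\<sigma> \<le> 1" and d: "0 \<le> d"
    and le: "AE z in P. \<sigma> * v z + (1 - \<sigma>) * (if snd z < T then d else 0) \<le> u z"
  shows "AE z in P. \<sigma> * v z + (1 - \<sigma>) * (g z + (if snd z < T then 0 else G d * c)) \<le> u z"
proof -
  have u0: "AE z in P. 0 \<le> u z" and v0: "AE z in P. 0 \<le> v z"
    using u v by (simp_all add: nonneg_Linfty_solution_def)
  from v0 le h have "AE z in P. 0 \<le> v z \<and> p (snd z) \<le> h z \<and>
      \<sigma> * v z + (1 - \<sigma>) * (if snd z < T then d else 0) \<le> u z"
    by eventually_elim simp
  from AE_slice[OF this]
  have slice: "AE s in lebesgue. 0 < s \<longrightarrow> (AE y in M. 0 \<le> v (y, s) \<and> p s \<le> h (y, s) \<and>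
      \<sigma> * v (y, s) + (1 - \<sigma>) * (if s < T then d else 0) \<le> u (y, s))"
    by simp
  show ?thesis
    using solution_eq[OF u] solution_eq[OF v] AE_in_space AE_kernel_normalized v0 g u0
  proof eventually_elim
    case (elim z)
    define b where "b = (if snd z < T then 0 else G d * c)"
    have b: "0 \<le> b" using c(1) G_nonneg[OF d] by (simp add: b_def)
    let ?I = "\<integral>\<^sup>+ s. ennreal (p s) * indicator {0<..<min (snd z) T} s \<partial>lebesgue"
    have "ennreal ((1 - \<sigma>) * b) \<le> ennreal ((1 - \<sigma>) * G d) * ?I"
    proof (cases "snd z < T")
      case False
      then have "ennreal c \<le> ?I" using c(2) by (simp add: min_def)
      then have "ennreal ((1 - \<sigma>) * G d) * ennreal c \<le> ennreal ((1 - \<sigma>) * G d) * ?I"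
        by (intro mult_left_mono) auto
      then show ?thesis
        using False \<sigma> c(1) G_nonneg[OF d] by (simp add: b_def ennreal_mult[symmetric] ac_simps)
    qed (simp add: b_def)
    moreover have "ennreal \<sigma> * memory_term M K h G v (fst z) (snd z) + ennreal ((1 - \<sigma>) * G d) * ?I
        \<le> memory_term M K h G u (fst z) (snd z)"
      using elim K_nonneg
      by (intro memory_term_superlinear[OF G_conc G_mono G_0 \<sigma> d _ _ _ p slice] K_section_measurable) auto
    ultimately have mem: "ennreal \<sigma> * memory_term M K h G v (fst z) (snd z) + ennreal ((1 - \<sigma>) * b)
        \<le> memory_term M K h G u (fst z) (snd z)"
      by (meson add_left_mono order_trans)
    \<comment> \<open>The equation for \<open>v\<close> forces its memory term to be finite.\<close>
    obtain r where r: "0 \<le> r" "memory_term M K h G v (fst z) (snd z) = ennreal r"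
      using elim(2) by (cases "memory_term M K h G v (fst z) (snd z)") auto
    have "ennreal (v z) = ennreal (g z + r)" using elim(2,6) r by simp
    then have vz: "v z = g z + r" using elim(5,6) r(1) by (simp del: ennreal_plus)
    have "ennreal (g z + \<sigma> * r + (1 - \<sigma>) * b)
        = ennreal (g z) + (ennreal \<sigma> * ennreal r + ennreal ((1 - \<sigma>) * b))"
      using elim(6) r(1) \<sigma> b by (simp add: ennreal_mult[symmetric] add.assoc)
    also have "\<dots> \<le> ennreal (u z)"
      unfolding elim(1) using mem r(2) by (intro add_left_mono) simp
    finally have "ennreal (g z + \<sigma> * r + (1 - \<sigma>) * b) \<le> ennreal (u z)" .
    then have "g z + \<sigma> * r + (1 - \<sigma>) * b \<le> u z"
      using elim(7) by (simp only: ennreal_le_iff)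
    then show ?case unfolding vz b_def[symmetric] by (simp add: algebra_simps)
  qed
qed

text \<open>A single pair \<open>u, v\<close> is compared by improving \<open>\<sigma> v \<le> u\<close> to
  \<open>(\<sigma> + (1 - \<sigma>) q) v \<le> u\<close> with a fixed \<open>q > 0\<close>; iteration from \<open>\<sigma> = 0\<close> gives \<open>v \<le> u\<close>.\<close>

lemma solution_ge_solution:
  assumes u: "nonneg_Linfty_solution M K g h G u" and v: "nonneg_Linfty_solution M K g h G v"
    and g: "AE z in P. 0 \<le> g z" "AE z in P. snd z < T \<longrightarrow> \<beta> \<le> g z"
    and p: "p \<in> borel_measurable Rplus" "\<And>s. 0 < s \<Longrightarrow> 0 \<le> p s"
    and h: "AE z in P. p (snd z) \<le> h z"
    and c: "0 < c" "ennreal c \<le> (\<integral>\<^sup>+ s. ennreal (p s) * indicator {0<..<T} s \<partial>lebesgue)"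
    and \<beta>: "0 < \<beta>" "0 < G \<beta>" "\<beta> \<le> \<xi>" and v_le: "AE z in P. v z \<le> \<xi>"
  shows "AE z in P. v z \<le> u z"
proof -
  define \<kappa> where "\<kappa> = min \<beta> (G \<beta> * c)"
  define q where "q = \<kappa> / \<xi>"
  have \<kappa>: "0 < \<kappa>" "\<kappa> \<le> \<beta>" "\<kappa> \<le> G \<beta> * c" using \<beta> c by (auto simp: \<kappa>_def)
  have \<xi>: "0 < \<xi>" using \<beta> by simp
  have q: "0 < q" "q \<le> 1" "q * \<xi> = \<kappa>" using \<kappa> \<beta>(3) \<xi> by (simp_all add: q_def)
  have improve: "AE z in P. (\<sigma> + (1 - \<sigma>) * q) * v z \<le> u z"
    if \<sigma>: "0 \<le> \<sigma>" "\<sigma> \<le> 1" and le: "AE z in P. \<sigma> * v z \<le> u z" for \<sigma>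
  proof -
    \<comment> \<open>With surplus \<open>0\<close> the equation yields the surplus \<open>\<beta>\<close> before time \<open>T\<close>; with that surplus it
      yields one at all times.\<close>
    have "AE z in P. \<sigma> * v z + (1 - \<sigma>) * (g z + (if snd z < T then 0 else G 0 * c)) \<le> u z"
      using le c by (intro solution_superlinear[OF u v g(1) p h _ c(2) \<sigma>]) auto
    with g(2) le have "AE z in P. \<sigma> * v z + (1 - \<sigma>) * (if snd z < T then \<beta> else 0) \<le> u z"
    proof eventually_elim
      case (elim z)
      show ?case
      proof (cases "snd z < T")
        case True
        then have "(1 - \<sigma>) * \<beta> \<le> (1 - \<sigma>) * g z" using elim(1) \<sigma> by (intro mult_left_mono) auto
        with elim(3) True show ?thesis by simp
      qed (use elim(2) in simp)
    qed
    then have "AE z in P. \<sigma> * v z + (1 - \<sigma>) * (g z + (if snd z < T then 0 else G \<beta> * c)) \<le> u z"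
      using c \<beta> by (intro solution_superlinear[OF u v g(1) p h _ c(2) \<sigma>]) auto
    then show ?thesis
      using g v_le
    proof eventually_elim
      case (elim z)
      have "q * v z \<le> \<kappa>"
        using mult_left_mono[OF elim(4), of q] q by simp
      also have "\<kappa> \<le> g z + (if snd z < T then 0 else G \<beta> * c)"
        using \<kappa> elim(2,3) by (cases "snd z < T") simp_all
      finally have "(1 - \<sigma>) * (q * v z) \<le> (1 - \<sigma>) * (g z + (if snd z < T then 0 else G \<beta> * c))"
        using \<sigma> by (intro mult_left_mono) auto
      with elim(1) show ?case by (simp add: algebra_simps)
    qed
  qed
  have "AE z in P. (1 - (1 - q) ^ n) * v z \<le> u z" for n
  proof (induction n)
    case 0
    have "AE z in P. 0 \<le> u z" using u by (simp add: nonneg_Linfty_solution_def)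
    then show ?case by eventually_elim simp
  next
    case (Suc n)
    define x where "x = (1 - q) ^ n"
    have "0 \<le> x" "x \<le> 1" unfolding x_def using q by (simp_all add: power_le_one)
    then have "0 \<le> 1 - x" "1 - x \<le> 1" by simp_all
    from improve[OF this Suc.IH[folded x_def]]
    have "AE z in P. ((1 - x) + (1 - (1 - x)) * q) * v z \<le> u z" .
    moreover have "(1 - x) + (1 - (1 - x)) * q = 1 - (1 - q) * x"
      by (simp add: algebra_simps)
    ultimately show ?case by (simp only: power_Suc x_def[symmetric])
  qed
  then have "AE z in P. \<forall>n. (1 - (1 - q) ^ n) * v z \<le> u z"
    unfolding AE_all_countable ..
  then show ?thesis
  proof eventually_elim
    case (elim z)
    have "(\<lambda>n. (1 - q) ^ n) \<longlonglongrightarrow> 0"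
      using q by (intro LIMSEQ_realpow_zero) simp_all
    from tendsto_mult[OF tendsto_diff[OF tendsto_const this] tendsto_const]
    have "(\<lambda>n. (1 - (1 - q) ^ n) * v z) \<longlonglongrightarrow> (1 - 0) * v z" .
    then have "(1 - 0) * v z \<le> u z"
      by (rule LIMSEQ_le_const2) (rule exI[of _ 0], simp only: elim simp_thms)
    then show ?case by simp
  qed
qed

end

text \<open>The function \<open>w - G w\<close> is convex and vanishes at \<open>0\<close>, so it strictly exceeds a positive value
  everywhere to the right of a point where that value is attained.\<close>

lemma concave_sublevel_bound:
  fixes G :: "real \<Rightarrow> real"
  assumes G: "concave_on {0..} G" "G 0 = 0" and \<xi>: "0 \<le> \<xi>" "0 < \<xi> - G \<xi>"
    and le: "U - G U \<le> \<xi> - G \<xi>"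
  shows "U \<le> \<xi>"
proof (rule ccontr)
  assume "\<not> U \<le> \<xi>"
  then have U: "\<xi> < U" "0 < U" using \<xi> by auto
  define \<tau> where "\<tau> = \<xi> / U"
  have \<tau>: "0 \<le> \<tau>" "\<tau> < 1" "\<tau> * U = \<xi>" using U \<xi> by (auto simp: \<tau>_def)
  have "\<tau> * G U \<le> G \<xi>"
    using concave_onD[OF G(1), of \<tau> 0 U] \<tau> U G(2) by simp
  then have "\<xi> - G \<xi> \<le> \<tau> * (U - G U)" using \<tau>(3) by (simp add: algebra_simps)
  also have "\<dots> \<le> \<tau> * (\<xi> - G \<xi>)" using le \<tau>(1) by (rule mult_left_mono)
  also have "\<dots> < \<xi> - G \<xi>" using \<tau>(2) \<xi>(2) by simp
  finally show False by simp
qed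

section \<open>Uniqueness\<close>

theorem theorem4p1:
  fixes M :: "'a measure"
    and K :: "'a \<times> 'a \<times> real \<Rightarrow> real"
    and g h :: "'a \<times> real \<Rightarrow> real"
    and G \<phi> p1 p2 :: "real \<Rightarrow> real"
    and T0 \<beta>0 \<xi> :: real
  assumes K_meas: "K \<in> borel_measurable (M \<Otimes>\<^sub>M M \<Otimes>\<^sub>M Rplus)"
    and K_nonneg: "\<forall>x\<in>space M. \<forall>y\<in>space M. \<forall>t>0. 0 \<le> K (x, y, t)"
    and K_int: "AE (x, t) in caratheodory_prod M Rplus. (\<integral>\<^sup>+ y. ennreal (K (x, y, t)) \<partial>M) = 1"
    and g_Linfty: "g \<in> Linfty_space (caratheodory_prod M Rplus)"
    and g_nonneg: "\<forall>x\<in>space M. \<forall>t>0. 0 \<le> g (x, t)"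
    and T0: "0 < T0"
    and g_inf: "(INF z\<in>space M \<times> {0<..<T0}. g z) = \<beta>0" "0 < \<beta>0"
    and h_meas: "h \<in> borel_measurable (caratheodory_prod M Rplus)"
    and h_nonneg: "\<forall>x\<in>space M. \<forall>t>0. 0 \<le> h (x, t)"
    and G_nonneg: "\<forall>u\<ge>0. 0 \<le> G u"
    and G_cont: "continuous_on {0..} G"
    and G_mono: "strict_mono_on {0..} G"
    and G_conc: "concave_on {0..} G"
    and G_0: "G 0 = 0"
    and p1: "continuous_on {0<..} p1" "\<forall>t>0. 0 < p1 t"
    and p2: "continuous_on {0<..} p2" "\<forall>t>0. 0 < p2 t"
    and \<xi>: "0 < \<xi>"
    and \<phi>_homeo: "\<exists>\<psi>. homeomorphism {0..1} {0..1} \<phi> \<psi>"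
    and i: "\<exists>t>0. p1 t \<noteq> p2 t" "has_bochner_integral Rplus p2 1"
    and ii: "\<exists>L>0. ((\<lambda>t. p1 t / p2 t) \<longlongrightarrow> L) (at_right 0)"
    and iii: "AE (x, t) in caratheodory_prod M Rplus. p1 t \<le> h (x, t) \<and> h (x, t) \<le> p2 t"
    and iv: "\<phi> 0 = 0" "\<phi> 1 = 1" "concave_on {0..1} \<phi>"
    and v: "\<xi> - G \<xi> = Linfty_norm (caratheodory_prod M Rplus) g"
    and vi: "\<forall>\<sigma>\<in>{0..1}. \<forall>u\<in>{0..\<xi>}. G (\<sigma> * u) \<ge> \<phi> \<sigma> * G u"
  shows "\<not> (\<exists>u v. nonneg_Linfty_solution M K g h G u \<and> nonneg_Linfty_solution M K g h G v \<and>
           \<not> (AE z in caratheodory_prod M Rplus. u z = v z))"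
proof -
  let ?P = "caratheodory_prod M Rplus"
  have "G 0 < G \<beta>0" using g_inf(2) by (intro strict_mono_onD[OF G_mono]) auto
  then have G\<beta>: "0 < G \<beta>0" using G_0 by simp
  have G_mono': "mono_on {0..} G" using G_mono by (rule strict_mono_on_imp_mono_on)
  interpret volterra_kernel M K G
    using K_meas K_nonneg K_int G_conc G_mono' G_0 by unfold_locales
  have "AE z in ?P. u z = v z"
    if sol_u: "nonneg_Linfty_solution M K g h G u" and sol_v: "nonneg_Linfty_solution M K g h G v"
    for u v
  proof (cases "emeasure ?P (space ?P) = 0")
    case True
    then have "space ?P \<in> null_sets ?P" by auto
    then show ?thesis by (rule AE_I') auto
  next
    case False
    let ?N = "Linfty_norm ?P g"
    have not_AE_False: "\<not> (AE z in ?P. False)"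
      using False by (simp add: ae_filter_eq_bot_iff[symmetric] trivial_limit_def)
    have norm_nonneg: "0 \<le> Linfty_norm ?P f" if "f \<in> Linfty_space ?P" for f
    proof (rule ccontr)
      assume neg: "\<not> 0 \<le> Linfty_norm ?P f"
      have "AE z in ?P. False"
        using AE_le_Linfty_norm[OF that False] by eventually_elim (use neg in linarith)
      with not_AE_False show False ..
    qed
    have g0: "AE z in ?P. 0 \<le> g z"
      using AE_in_space by eventually_elim (use g_nonneg in force)
    have g_bound: "AE z in ?P. g z \<le> ?N"
      using AE_le_Linfty_norm[OF g_Linfty False] by eventually_elim simp
    have g_lower: "\<beta>0 \<le> g z" if "z \<in> space M \<times> {0<..<T0}" for z
      unfolding g_inf(1)[symmetric]
      using that g_nonneg by (intro cINF_lower bdd_belowI[where m = 0]) auto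
    have g_lower_AE: "AE z in ?P. snd z < T0 \<longrightarrow> \<beta>0 \<le> g z"
      using AE_in_space by eventually_elim (use g_lower in \<open>auto simp: mem_Times_iff\<close>)
    \<comment> \<open>Otherwise the strip \<open>t < T0\<close> would be a null set, and so would be \<open>M\<close>.\<close>
    have \<beta>N: "\<beta>0 \<le> ?N"
    proof (rule ccontr)
      assume less: "\<not> \<beta>0 \<le> ?N"
      have "AE z in ?P. \<not> snd z < T0"
        using g_lower_AE g_bound by eventually_elim (use less in auto)
      from AE_slice[OF this] have slice: "AE t in lebesgue. 0 < t \<longrightarrow> (AE y in M. \<not> t < T0)"
        by simp
      have "AE y in M. False"
      proof (rule ccontr)
        assume "\<not> (AE y in M. False)"
        then have "AE t in lebesgue. t \<notin> {0<..<T0}"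
          using slice by (auto elim!: eventually_mono)
        with not_AE_notin_interval[OF T0] show False ..
      qed
      from AE_caratheodory_prod_fst[OF this, of Rplus] not_AE_False show False by (rule notE[rotated])
    qed
    have p1': "p1 \<in> borel_measurable Rplus" "\<And>s. 0 < s \<Longrightarrow> 0 \<le> p1 s"
      using p1 by (auto intro!: continuous_imp_measurable_on_sets_lebesgue simp: less_imp_le)
    have p2': "p2 \<in> borel_measurable Rplus" "\<And>s. 0 < s \<Longrightarrow> 0 \<le> p2 s"
      using p2 by (auto intro!: continuous_imp_measurable_on_sets_lebesgue simp: less_imp_le)
    have "(\<integral>\<^sup>+ s. ennreal (p2 s) \<partial>Rplus) = ennreal (\<integral> s. p2 s \<partial>Rplus)"
      using i(2) p2'(2) by (intro nn_integral_eq_integral)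
        (auto simp: has_bochner_integral_iff AE_Rplus_iff)
    then have p2_int: "(\<integral>\<^sup>+ s. ennreal (p2 s) \<partial>Rplus) = 1"
      using i(2) by (simp add: has_bochner_integral_iff)
    have h: "AE z in ?P. p1 (snd z) \<le> h z" "AE z in ?P. h z \<le> p2 (snd z)"
      using iii by (simp_all add: split_def AE_conj_iff)
    have bound: "AE z in ?P. w z \<le> \<xi>" if w: "nonneg_Linfty_solution M K g h G w" for w
    proof -
      have wL: "w \<in> Linfty_space ?P" and w0: "AE z in ?P. 0 \<le> w z"
        using w by (auto simp: nonneg_Linfty_solution_def)
      let ?W = "Linfty_norm ?P w"
      have wW: "AE z in ?P. w z \<le> ?W"
        using AE_le_Linfty_norm[OF wL False] by eventually_elim simp
      have "AE z in ?P. w z \<le> ?N + G ?W"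
        using solution_le[OF w wW norm_nonneg[OF wL] p2' _ h(2) g_bound norm_nonneg[OF g_Linfty]]
          p2_int by simp
      with w0 have "AE z in ?P. \<bar>w z\<bar> \<le> ?N + G ?W" by eventually_elim simp
      then have "?W \<le> ?N + G ?W" by (rule Linfty_norm_le[OF wL False])
      then have "0 \<le> \<xi>" "0 < \<xi> - G \<xi>" "?W - G ?W \<le> \<xi> - G \<xi>"
        using \<xi> \<beta>N g_inf(2) v by linarith+
      then have W: "?W \<le> \<xi>" by (rule concave_sublevel_bound[OF G_conc G_0])
      show ?thesis using wW by eventually_elim (use W in linarith)
    qed
    have "0 \<le> G \<xi>" using G_nonneg \<xi> by simp
    then have \<beta>\<xi>: "\<beta>0 \<le> \<xi>" using \<beta>N v by simp
    let ?I = "\<integral>\<^sup>+ s. ennreal (p1 s) * indicator {0<..<T0} s \<partial>lebesgue"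
    have "0 < ?I"
    proof (rule ccontr)
      assume "\<not> 0 < ?I"
      then have "?I = 0" by simp
      then have "AE s in lebesgue. ennreal (p1 s) * indicator {0<..<T0} s = 0"
        using borel_measurable_Rplus_cutoff[OF p1'(1)] by (simp add: nn_integral_0_iff_AE)
      then have "AE s in lebesgue. s \<notin> {0<..<T0}"
      proof eventually_elim
        case (elim s)
        have False if "s \<in> {0<..<T0}"
        proof -
          have "ennreal (p1 s) = 0" using elim that by simp
          moreover have "0 < p1 s" using p1(2) that by simp
          ultimately show False by simp
        qed
        then show ?case by blast
      qed
      with not_AE_notin_interval[OF T0] show False ..
    qed
    \<comment> \<open>The truncation at \<open>1\<close> spares a proof that \<open>p1\<close> is integrable.\<close>
    define c where "c = enn2real (min 1 ?I)"
    have fin: "min 1 ?I < top" by (simp add: min_less_iff_disj)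
    have c: "0 < c" "ennreal c \<le> ?I"
      using \<open>0 < ?I\<close> fin by (auto simp: c_def enn2real_positive_iff)
    have cmp: "AE z in ?P. v z \<le> u z"
      if "nonneg_Linfty_solution M K g h G u" "nonneg_Linfty_solution M K g h G v" for u v
      by (rule solution_ge_solution[OF that g0 g_lower_AE p1' h(1) c g_inf(2) G\<beta> \<beta>\<xi> bound[OF that(2)]])
    from cmp[OF sol_u sol_v] cmp[OF sol_v sol_u] show ?thesis by eventually_elim simp
  qed
  then show ?thesis by blast
qed

end
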